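(* Let $\mu\ge1$ be an odd integer, let $j\in\{0,1,2,\ldots\}$, and let $\vartheta,\varphi$ be real with $\cos\vartheta+\cos\varphi>0$. Set $a:=\frac{\sin\vartheta}{\cos\vartheta+\cos\varphi}$ and $b:=\frac{\sin\varphi}{\cos\vartheta+\cos\varphi}$. Then $$\int_0^\infty L_j^\mu(2x)\,\widetilde{J}_{\frac{\mu}{2}}(ax)\cos(bx)\,x^\mu e^{-x}\,\mathrm{d}x = (-1)^j\frac{2^\mu}{\sqrt{\pi}}\left(\frac{\cos\vartheta+\cos\varphi}{2}\right)^{\frac{\mu+1}{2}}\cos\left(\left(j+\tfrac{\mu+1}{2}\right)\varphi\right)\widetilde{C}_j^{\frac{\mu+1}{2}}(\cos\vartheta)$$ and $$\int_0^\infty L_j^\mu(2x)\,\widetilde{J}_{\frac{\mu}{2}}(ax)\sin(bx)\,x^\mu e^{-x}\,\mathrm{d}x = (-1)^j\frac{2^\mu}{\sqrt{\pi}}\left(\frac{\cos\vartheta+\cos\varphi}{2}\right)^{\frac{\mu+1}{2}}\sin\left(\left(j+\tfrac{\mu+1}{2}\right)\varphi\right)\widetilde{C}_j^{\frac{\mu+1}{2}}(\cos\vartheta).$$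
   Context: $L_j^\mu$ is the classical (generalized) Laguerre polynomial of degree $j$ with parameter $\mu$. $\widetilde{J}_\alpha(z)=(\frac z2)^{-\alpha}J_\alpha(z)$ is the normalized $J$-Bessel function (extended to an even entire function). $\widetilde{C}_n^\lambda(x)=\Gamma(\lambda)C_n^\lambda(x)$ is the normalized Gegenbauer polynomial, where $C_n^\lambda$ is the usual Gegenbauer polynomial. *)

theory Defs
  imports "HOL-Complex_Analysis.Complex_Analysis"
begin

definition laguerre :: "nat \<Rightarrow> real \<Rightarrow> real \<Rightarrow> real" where
  "laguerre n \<mu> x =
     (\<Sum>k\<le>n. (-1) ^ k * ((real n + \<mu>) gchoose (n - k)) * x ^ k / fact k)"

(* pochhammer \<nu> m = Gamma (\<nu> + m) / Gamma \<nu>, continued to all \<nu> *)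
definition gegenbauer :: "nat \<Rightarrow> real \<Rightarrow> real \<Rightarrow> real" where
  "gegenbauer n \<nu> x =
     (\<Sum>k\<le>n div 2. (-1) ^ k * pochhammer \<nu> (n - k) / (fact k * fact (n - 2 * k))
        * (2 * x) ^ (n - 2 * k))"

definition gegenbauer_norm :: "nat \<Rightarrow> real \<Rightarrow> real \<Rightarrow> real" where
  "gegenbauer_norm n \<nu> x = Gamma \<nu> * gegenbauer n \<nu> x"

(* Principal branch, cut along the nonpositive reals. The reciprocal Gamma function
   makes the terms with a pole of Gamma vanish. *)
definition bessel_J :: "complex \<Rightarrow> complex \<Rightarrow> complex" where
  "bessel_J \<alpha> z =
     (\<Sum>k. (-1) ^ k * rGamma (\<alpha> + of_nat k + 1) / fact k * (z / 2) powr (\<alpha> + 2 * of_nat k))"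

(* The even entire extension of (z/2) powr (-\<alpha>) * bessel_J \<alpha> z, given by its power series;
   see bessel_J_norm_eq, holomorphic_bessel_J_norm and bessel_J_norm_minus. *)
definition bessel_J_norm :: "'a \<Rightarrow> 'a \<Rightarrow> 'a::Gamma" where
  "bessel_J_norm \<alpha> z =
     (\<Sum>k. (-1) ^ k * rGamma (\<alpha> + of_nat k + 1) / fact k * (z / 2) ^ (2 * k))"

lemma summable_bessel_J_norm:
  fixes \<alpha> w :: complex
  shows "summable (\<lambda>k. (-1) ^ k * rGamma (\<alpha> + of_nat k + 1) / fact k * w ^ k)"
proof -
  let ?t = "\<lambda>k. (-1) ^ k * rGamma (\<alpha> + of_nat k + 1) / fact k * w ^ k"
  obtain N :: nat where N: "real N \<ge> norm \<alpha> + 2 * norm w"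
    using real_arch_simple by blast
  show ?thesis
  proof (rule summable_ratio_test[of "1/2" N])
    fix k assume k: "k \<ge> N"
    let ?b = "\<alpha> + of_nat k + 1"
    have kN: "real k \<ge> norm \<alpha> + 2 * norm w" using N k by linarith
    have "norm (of_nat (k + 1) :: complex) - norm \<alpha> \<le> norm (of_nat (k + 1) + \<alpha>)"
      by (rule norm_diff_ineq)
    also have "of_nat (k + 1) + \<alpha> = ?b" by simp
    finally have "real k + 1 - norm \<alpha> \<le> norm ?b" unfolding norm_of_nat by simp
    hence b1: "norm ?b \<ge> 1" using kN norm_ge_zero[of w] by linarith
    have rG: "rGamma ?b = ?b * rGamma (?b + 1)" by (rule rGamma_plus1 [symmetric])
    have f: "norm (fact (Suc k) :: complex) = (real k + 1) * fact k"
      unfolding norm_fact by simp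
    have arg: "\<alpha> + of_nat (Suc k) + 1 = ?b + 1" by simp
    have n1: "norm (?t (Suc k)) = norm w / (real k + 1) * (norm (rGamma (?b + 1)) / fact k * norm w ^ k)"
      unfolding arg norm_mult norm_divide f norm_power by simp
    have n2: "norm (?t k) = norm ?b * (norm (rGamma (?b + 1)) / fact k * norm w ^ k)"
      by (subst rG) (simp add: norm_mult norm_divide norm_power norm_fact)
    have "norm w / (real k + 1) \<le> 1 / 2"
    proof -
      have "norm w * 2 \<le> real k + 1" using kN norm_ge_zero[of \<alpha>] by linarith
      thus ?thesis by (simp add: field_simps)
    qed
    also have "\<dots> \<le> 1 / 2 * norm ?b" using b1 by simp
    finally have "norm w / (real k + 1) \<le> 1 / 2 * norm ?b" .
    from mult_right_mono[OF this, of "norm (rGamma (?b + 1)) / fact k * norm w ^ k"]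
    show "norm (?t (Suc k)) \<le> 1 / 2 * norm (?t k)"
      unfolding n1 n2 by (simp add: mult.assoc)
  qed simp
qed

lemma holomorphic_bessel_J_norm: "bessel_J_norm (\<alpha>::complex) holomorphic_on UNIV"
proof -
  let ?c = "\<lambda>k. (-1) ^ k * rGamma (\<alpha> + of_nat k + 1) / fact k"
  let ?F = "\<lambda>w. \<Sum>k. ?c k * w ^ k"
  have "?F field_differentiable at w" for w
    using termdiffs_strong_converges_everywhere[of ?c w] summable_bessel_J_norm
    unfolding field_differentiable_def by blast
  hence "?F holomorphic_on UNIV"
    by (simp add: holomorphic_on_def field_differentiable_at_within)
  hence "?F \<circ> (\<lambda>z. (z / 2)\<^sup>2) holomorphic_on UNIV"
    by (intro holomorphic_on_compose_gen[where t = UNIV] holomorphic_intros) auto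
  also have "?F \<circ> (\<lambda>z. (z / 2)\<^sup>2) = bessel_J_norm \<alpha>"
    by (simp add: fun_eq_iff bessel_J_norm_def power_mult del: power_divide)
  finally show ?thesis .
qed

lemma bessel_J_norm_minus: "bessel_J_norm \<alpha> (- z) = bessel_J_norm \<alpha> z"
  by (simp add: bessel_J_norm_def power_mult)

lemma bessel_J_norm_eq:
  assumes "z \<noteq> (0::complex)"
  shows "bessel_J_norm \<alpha> z = (z / 2) powr (- \<alpha>) * bessel_J \<alpha> z"
proof -
  let ?t = "\<lambda>k. (-1) ^ k * rGamma (\<alpha> + of_nat k + 1) / fact k * (z / 2) ^ (2 * k)"
  have s: "summable ?t"
    using summable_bessel_J_norm[of \<alpha> "(z / 2)\<^sup>2"] by (simp only: power_mult)
  have p: "(z / 2) powr (\<alpha> + 2 * of_nat k) = (z / 2) powr \<alpha> * (z / 2) ^ (2 * k)" for k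
  proof -
    have "(z / 2) powr (of_nat (2 * k)) = (z / 2) ^ (2 * k)"
      by (rule powr_nat') (use assms in auto)
    thus ?thesis by (simp only: powr_add of_nat_mult of_nat_numeral)
  qed
  have "bessel_J \<alpha> z = (\<Sum>k. (z / 2) powr \<alpha> * ?t k)"
    unfolding bessel_J_def p by (simp only: mult_ac times_divide_eq_left times_divide_eq_right)
  also have "\<dots> = (z / 2) powr \<alpha> * bessel_J_norm \<alpha> z"
    unfolding bessel_J_norm_def by (rule suminf_mult[OF s])
  finally have "bessel_J \<alpha> z = (z / 2) powr \<alpha> * bessel_J_norm \<alpha> z" .
  moreover have "(z / 2) powr (- \<alpha>) * (z / 2) powr \<alpha> = 1"
    using assms by (simp flip: powr_add)
  ultimately show ?thesis by (simp flip: mult.assoc)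
qed

lemma bessel_J_norm_of_real:
  "bessel_J_norm (of_real \<alpha>) (of_real x) = (of_real (bessel_J_norm \<alpha> x) :: complex)"
proof -
  let ?t = "\<lambda>k. (-1) ^ k * rGamma (\<alpha> + of_nat k + 1) / fact k * (x / 2) ^ (2 * k)"
  have e: "(-1) ^ k * rGamma (of_real \<alpha> + of_nat k + 1) / fact k * (of_real x / 2) ^ (2 * k)
          = (of_real (?t k) :: complex)" for k
    by (simp flip: rGamma_complex_of_real)
  have "summable (\<lambda>k. of_real (?t k) :: complex)"
    using summable_bessel_J_norm[of "of_real \<alpha>" "(of_real x / 2)\<^sup>2"]
    by (simp only: power_mult [symmetric] e)
  hence "summable ?t" by (rule summable_of_real_iff [THEN iffD1])
  thus ?thesis unfolding bessel_J_norm_def e by (rule suminf_of_real [symmetric])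
qed

end

theory Submission
  imports Defs
begin

text \<open>The parameter \<open>b\<close> enters only through the complex frequency \<open>p = 1 - \<i> b\<close>: the two
integrals are the real and imaginary parts of the Laplace transform at \<open>p\<close> of
\<open>x ^ \<mu> L_j(2 x) J(a x)\<close>, where \<open>J\<close> is the normalized Bessel function of order \<open>\<mu> / 2\<close>.
Without the Laguerre factor this transform is the classical
\<open>c / (p\<^sup>2 + a\<^sup>2) ^ \<lambda>\<close> with \<open>\<lambda> = (\<mu> + 1) / 2\<close>. An extra factor \<open>x ^ k\<close> amounts to
\<open>k\<close> differentiations in \<open>-p\<close>, so the moments divided by \<open>k!\<close> are the Taylor
coefficients of \<open>c / ((p - s)\<^sup>2 + a\<^sup>2) ^ \<lambda>\<close> in \<open>s\<close>. Passing from moments to Laguerre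
coefficients is, for generating functions, the substitution \<open>s = - 2 t / (1 - t)\<close>
together with the factor \<open>(1 - t) ^ (- 2 \<lambda>)\<close>. This factor clears the denominators and
leaves \<open>c\<close> divided by the \<open>\<lambda>\<close>-th power of a quadratic polynomial in \<open>t\<close>, namely of
\<open>(p (1 - t) + 2 t)\<^sup>2 + a\<^sup>2 (1 - t)\<^sup>2\<close>. With the given \<open>a\<close> and \<open>b\<close> it equals
\<open>2 / (cos \<theta> + cos \<phi>) e ^ (- \<i> \<phi>) (1 - 2 cos \<theta> u + u\<^sup>2)\<close> for \<open>u = - e ^ (\<i> \<phi>) t\<close>, and
\<open>(1 - 2 cos \<theta> u + u\<^sup>2) ^ (- \<lambda>)\<close> is the generating function of the Gegenbauer
polynomials of parameter \<open>\<lambda>\<close>.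

The number \<open>a\<close> can exceed \<open>|p|\<close>, where integrating the Bessel series term by term
diverges. The moments are therefore found from the two ladder relations of the
normalized Bessel functions: integrated by parts
(\<open>bessel_laplace_lower\<close>, \<open>bessel_laplace_raise\<close>) they become algebraic relations between
moments, which fix the leading moment (\<open>bessel_laplace_closed_form\<close>) and give a
three-term recurrence for the others (\<open>bessel_laplace_recurrence\<close>). That recurrence is
the differential equation of \<open>((p - s)\<^sup>2 + a\<^sup>2) ^ (- \<lambda>)\<close>
(\<open>bessel_laplace_generating_function\<close>). Since \<open>\<mu>\<close> is odd, \<open>\<lambda>\<close> is a natural number,
all generating functions are formal power series, and the order of \<open>J\<close> is half an odd
integer, which lets the ladder start at order \<open>- 1 / 2\<close>, where the function is
a multiple of the cosine.\<close>

section \<open>Normalized Bessel functions on the real line\<close>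

lemma summable_bessel_J_norm_real:
  fixes \<alpha> w :: real
  shows "summable (\<lambda>k. (-1) ^ k * rGamma (\<alpha> + of_nat k + 1) / fact k * w ^ k)"
proof -
  have "(-1) ^ k * rGamma (of_real \<alpha> + of_nat k + 1) / fact k * of_real w ^ k
          = (of_real ((-1) ^ k * rGamma (\<alpha> + of_nat k + 1) / fact k * w ^ k) :: complex)" for k
    by (simp flip: rGamma_complex_of_real)
  with summable_bessel_J_norm[of "of_real \<alpha>" "of_real w"]
  have "summable (\<lambda>k. of_real ((-1) ^ k * rGamma (\<alpha> + of_nat k + 1) / fact k * w ^ k) :: complex)"
    by (simp only:)
  thus ?thesis by (rule summable_of_real_iff [THEN iffD1])
qed

lemma has_real_derivative_bessel_J_norm:
  fixes \<alpha> z :: real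
  shows "(bessel_J_norm \<alpha> has_real_derivative - (z / 2) * bessel_J_norm (\<alpha> + 1) z) (at z)"
proof -
  define c where "c = (\<lambda>\<alpha> k. (-1) ^ k * rGamma (\<alpha> + of_nat k + 1) / fact k :: real)"
  have "((\<lambda>w. \<Sum>k. c \<alpha> k * w ^ k) has_real_derivative (\<Sum>k. diffs (c \<alpha>) k * ((z/2)^2) ^ k)) (at ((z/2)^2))"
    by (rule termdiffs_strong_converges_everywhere)
       (simp only: c_def summable_bessel_J_norm_real)
  moreover have "diffs (c \<alpha>) k = - c (\<alpha> + 1) k" for k
    by (simp add: diffs_def c_def add_ac divide_simps)
  ultimately have "((\<lambda>w. \<Sum>k. c \<alpha> k * w ^ k) has_real_derivative
      (- (\<Sum>k. c (\<alpha> + 1) k * ((z/2)^2) ^ k))) (at ((z/2)^2))"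
    using summable_bessel_J_norm_real[of "\<alpha> + 1" "(z/2)^2"]
    by (simp add: c_def suminf_minus)
  moreover have "((\<lambda>z. (z/2)^2) has_real_derivative z / 2) (at z)"
    by (auto intro!: derivative_eq_intros)
  ultimately have "((\<lambda>z. \<Sum>k. c \<alpha> k * ((z/2)^2) ^ k) has_real_derivative
      (- (\<Sum>k. c (\<alpha> + 1) k * ((z/2)^2) ^ k)) * (z / 2)) (at z)"
    by (rule DERIV_chain2)
  moreover have "bessel_J_norm \<beta> = (\<lambda>z. \<Sum>k. c \<beta> k * ((z/2)^2) ^ k)" for \<beta>
    by (simp add: fun_eq_iff bessel_J_norm_def c_def power_mult del: power_divide)
  ultimately show ?thesis by (simp only: mult_minus_left mult_minus_right mult.commute)
qed

text \<open>Writing the series in \<open>w = (z / 2)\<^sup>2\<close>, the relation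
\<open>rGamma (\<alpha> + k + 1) = (\<alpha> + 1 + k) rGamma (\<alpha> + k + 2)\<close> splits each coefficient of order \<open>\<alpha>\<close>
in two: the part with \<open>\<alpha> + 1\<close> is a multiple of the coefficient of order \<open>\<alpha> + 1\<close>, and in the
part with \<open>k\<close> this factor cancels against \<open>k!\<close> and shifts the index.\<close>

lemma bessel_J_norm_recurrence:
  fixes \<alpha> z :: real
  shows "bessel_J_norm \<alpha> z = (\<alpha> + 1) * bessel_J_norm (\<alpha> + 1) z - (z / 2)\<^sup>2 * bessel_J_norm (\<alpha> + 2) z"
proof -
  define w where "w = (z / 2)\<^sup>2"
  define c where "c = (\<lambda>\<alpha> k. (-1) ^ k * rGamma (\<alpha> + of_nat k + 1) / fact k * w ^ k)"
  have J: "bessel_J_norm \<beta> z = suminf (c \<beta>)" for \<beta>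
    by (simp add: bessel_J_norm_def c_def w_def power_mult del: power_divide)
  have S: "c \<beta> sums suminf (c \<beta>)" for \<beta>
    using summable_bessel_J_norm_real[of \<beta> w] by (simp add: c_def summable_sums)
  define d where "d = (\<lambda>k. real k * c (\<alpha> + 1) k)"
  have "d (Suc k) = - w * c (\<alpha> + 2) k" for k
    by (simp add: d_def c_def add_ac divide_simps)
  hence "(\<lambda>k. d (Suc k)) sums (- w * suminf (c (\<alpha> + 2)))"
    using sums_mult[OF S, of "- w" "\<alpha> + 2"] by simp
  hence "d sums (- w * suminf (c (\<alpha> + 2)))"
    by (subst (asm) sums_Suc_iff) (simp add: d_def)
  hence "(\<lambda>k. (\<alpha> + 1) * c (\<alpha> + 1) k + d k) sums
      ((\<alpha> + 1) * suminf (c (\<alpha> + 1)) + - w * suminf (c (\<alpha> + 2)))"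
    by (intro sums_add sums_mult S)
  moreover have "(\<alpha> + 1) * c (\<alpha> + 1) k + d k = c \<alpha> k" for k
  proof -
    have "rGamma (\<alpha> + of_nat k + 1) = (\<alpha> + of_nat k + 1) * rGamma (\<alpha> + 1 + of_nat k + 1)"
      using rGamma_plus1[of "\<alpha> + of_nat k + 1"] by (simp add: add_ac)
    thus ?thesis by (simp add: c_def d_def divide_simps) (simp add: algebra_simps)
  qed
  ultimately show ?thesis
    unfolding J w_def[symmetric] using S[of \<alpha>] sums_unique2 by fastforce
qed

text \<open>The ladder step down in the order. The weight is \<open>x ^ (2 \<alpha>)\<close> for the order
\<open>\<alpha> = m + 1 / 2\<close>, the one that removes the function of order \<open>\<alpha>\<close> itself from the derivative.\<close>

lemma has_real_derivative_power_times_bessel_J_norm: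
  "((\<lambda>x. x ^ (2 * m + 1) * bessel_J_norm (real m + 1 / 2) (a * x)) has_real_derivative
      2 * x ^ (2 * m) * bessel_J_norm (real m - 1 / 2) (a * x)) (at x)"
proof -
  have J: "((\<lambda>x. bessel_J_norm (real m + 1 / 2) (a * x)) has_real_derivative
      (- (a * x / 2) * bessel_J_norm (real m + 3 / 2) (a * x)) * a) (at x)"
  proof -
    have "(bessel_J_norm (real m + 1 / 2) has_real_derivative
        - (a * x / 2) * bessel_J_norm (real m + 3 / 2) (a * x)) (at (a * x))"
      using has_real_derivative_bessel_J_norm[of "real m + 1 / 2" "a * x"] by (simp add: add.assoc)
    thus ?thesis by (rule DERIV_chain2) (rule DERIV_cmult_Id)
  qed
  have "2 * x ^ (2 * m) * bessel_J_norm (real m - 1 / 2) (a * x)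
      = 2 * x ^ (2 * m) * ((real m + 1 / 2) * bessel_J_norm (real m + 1 / 2) (a * x)
          - (a * x / 2)\<^sup>2 * bessel_J_norm (real m + 3 / 2) (a * x))"
    using bessel_J_norm_recurrence[of "real m - 1 / 2" "a * x"] by (simp add: add_ac)
  also have "\<dots> = of_nat (2 * m + 1) * x ^ (2 * m) * bessel_J_norm (real m + 1 / 2) (a * x)
      + x ^ (2 * m + 1) * ((- (a * x / 2) * bessel_J_norm (real m + 3 / 2) (a * x)) * a)"
    by (simp add: field_simps power2_eq_square)
  finally show ?thesis
    using DERIV_mult[OF DERIV_pow[of "2 * m + 1" x] J] by (simp add: mult_ac add_ac)
qed

text \<open>Boundedness makes every moment converge as soon as \<open>Re p > 0\<close>. It climbs the ladder: the
derivative of \<open>x ^ (2 m + 1) J_(m + 1/2)\<close> is at most \<open>2 C x ^ (2 m)\<close> if \<open>C\<close> bounds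
\<open>J_(m - 1/2)\<close>, so the function grows no faster than \<open>2 C x ^ (2 m + 1)\<close>.\<close>

lemma bounded_bessel_J_norm:
  "\<exists>C. \<forall>x. \<bar>bessel_J_norm (real m - 1 / 2) x\<bar> \<le> C"
proof (induction m)
  case 0
  \<comment> \<open>The two ladder relations turn into the cosine-sine system for y and s, whose energy is constant.\<close>
  define y where "y = bessel_J_norm (- 1 / 2 :: real)"
  define s where "s = (\<lambda>x. x / 2 * bessel_J_norm (1 / 2 :: real) x)"
  have y': "(y has_real_derivative - s x) (at x)" for x
    using has_real_derivative_bessel_J_norm[of "- 1 / 2" x] by (simp add: y_def s_def)
  have s': "(s has_real_derivative y x) (at x)" for x
    using DERIV_cmult[OF has_real_derivative_power_times_bessel_J_norm[of 0 1 x], of "1/2"]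
    by (simp add: y_def s_def mult_ac)
  have "((\<lambda>x. (y x)\<^sup>2 + (s x)\<^sup>2) has_real_derivative 0) (at x)" for x
    by (auto intro!: derivative_eq_intros y' s')
  hence "(y x)\<^sup>2 + (s x)\<^sup>2 = (y 0)\<^sup>2 + (s 0)\<^sup>2" for x
    by (intro DERIV_isconst_all) blast
  moreover have "s 0 = 0" by (simp add: s_def)
  ultimately have "(y x)\<^sup>2 \<le> (y 0)\<^sup>2" for x
    by (metis add_0_right le_add_same_cancel1 zero_eq_power2 zero_le_power2)
  hence "\<bar>y x\<bar> \<le> \<bar>y 0\<bar>" for x
    by (simp add: abs_le_square_iff)
  thus ?case by (auto simp: y_def)
next
  case (Suc m)
  then obtain C where C: "\<And>x. \<bar>bessel_J_norm (real m - 1 / 2) x\<bar> \<le> C" by blast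
  define f where "f = (\<lambda>x. bessel_J_norm (real m + 1 / 2) x :: real)"
  have pos: "\<bar>f x\<bar> \<le> 2 * C" if "x > 0" for x
  proof -
    let ?g = "\<lambda>x. x ^ (2 * m + 1) * f x"
    have g': "(?g has_real_derivative 2 * t ^ (2 * m) * bessel_J_norm (real m - 1 / 2) t) (at t)" for t
      using has_real_derivative_power_times_bessel_J_norm[of m 1 t] by (simp add: f_def)
    have h': "((\<lambda>t. 2 * C * t ^ (2 * m + 1)) has_real_derivative
        2 * C * (of_nat (2 * m + 1) * t ^ (2 * m))) (at t)" for t
      using DERIV_cmult[OF DERIV_pow[of "2 * m + 1" t], of "2 * C"] by simp
    have bd: "\<bar>2 * t ^ (2 * m) * bessel_J_norm (real m - 1 / 2) t\<bar> 
        \<le> 2 * C * (of_nat (2 * m + 1) * t ^ (2 * m))" if "0 \<le> t" for t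
    proof -
      have "\<bar>2 * t ^ (2 * m) * bessel_J_norm (real m - 1 / 2) t\<bar> \<le> 2 * t ^ (2 * m) * C"
        using that C[of t] by (simp add: abs_mult mult_left_mono)
      also have "\<dots> \<le> 2 * t ^ (2 * m) * (C * of_nat (2 * m + 1))"
        using that C[of 0] by (intro mult_left_mono) (auto simp: mult_le_cancel_left1)
      finally show ?thesis by (simp add: mult_ac)
    qed
    have "2 * C * 0 ^ (2 * m + 1) - ?g 0 \<le> 2 * C * x ^ (2 * m + 1) - ?g x"
      using that
    proof (intro DERIV_nonneg_imp_nondecreasing[of 0 x "\<lambda>t. 2 * C * t ^ (2 * m + 1) - ?g t"])
      fix t :: real assume "0 \<le> t"
      thus "\<exists>y. ((\<lambda>t. 2 * C * t ^ (2 * m + 1) - ?g t) has_real_derivative y) (at t) \<and> 0 \<le> y"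
        using DERIV_diff[OF h' g', of t] bd[of t] by (meson abs_le_D1 diff_ge_0_iff_ge)
    qed simp
    moreover have "2 * C * 0 ^ (2 * m + 1) + ?g 0 \<le> 2 * C * x ^ (2 * m + 1) + ?g x"
      using that
    proof (intro DERIV_nonneg_imp_nondecreasing[of 0 x "\<lambda>t. 2 * C * t ^ (2 * m + 1) + ?g t"])
      fix t :: real assume "0 \<le> t"
      hence "0 \<le> 2 * C * (of_nat (2 * m + 1) * t ^ (2 * m)) + 2 * t ^ (2 * m) * bessel_J_norm (real m - 1 / 2) t"
        using bd[of t] by linarith
      thus "\<exists>y. ((\<lambda>t. 2 * C * t ^ (2 * m + 1) + ?g t) has_real_derivative y) (at t) \<and> 0 \<le> y"
        using DERIV_add[OF h' g', of t] by blast
    qed simp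
    ultimately have "x ^ (2 * m + 1) * \<bar>f x\<bar> \<le> x ^ (2 * m + 1) * (2 * C)"
      using that by (cases "f x \<ge> 0") (auto simp: mult_ac)
    thus ?thesis using that by simp
  qed
  have "\<bar>f x\<bar> \<le> max (2 * C) \<bar>f 0\<bar>" for x
  proof (cases x "0 :: real" rule: linorder_cases)
    case less
    thus ?thesis using pos[of "- x"] by (simp add: f_def bessel_J_norm_minus)
  next
    case greater
    thus ?thesis using pos[of x] by simp
  qed simp
  thus ?case by (auto simp: f_def add_ac)
qed

section \<open>Laplace transforms of functions of polynomial growth\<close>

lemma set_integrable_power_times_exp:
  fixes s :: real
  assumes "s > 0"
  shows "set_integrable lborel {0..} (\<lambda>x. x ^ n * exp (- (s * x)))"
proof -
  let ?f = "\<lambda>t. complex_of_real t powr (of_nat (Suc n) - 1) / of_real (exp (s * t))"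
  let ?h = "\<lambda>x. indicator {0<..} x *\<^sub>R (x ^ n * exp (- (s * x))) :: real"
  have "?f absolutely_integrable_on {0<..}"
    using assms by (intro absolutely_integrable_Gamma_integral) auto
  hence "set_integrable lebesgue {0<..} (\<lambda>t. norm (?f t))"
    by (rule set_integrable_norm)
  also have "?this \<longleftrightarrow> set_integrable lebesgue {0<..} (\<lambda>x. x ^ n * exp (- (s * x)))"
    by (intro set_integrable_cong refl)
       (auto simp: norm_divide norm_powr_real_powr powr_realpow norm_power exp_minus field_simps)
  finally have "integrable lebesgue ?h"
    by (simp only: set_integrable_def)
  hence "integrable lborel ?h"
    by (subst (asm) integrable_completion) auto
  hence "integrable lborel (\<lambda>x. indicator {0..} x *\<^sub>R (x ^ n * exp (- (s * x))))"
    by (subst integrable_discrete_difference[where X = "{0}" and g = ?h])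
       (auto split: split_indicator)
  thus ?thesis by (simp only: set_integrable_def)
qed

lemma set_integrable_laplace_bounded:
  fixes g :: "real \<Rightarrow> real" and p :: complex
  assumes "continuous_on UNIV g" "\<And>x. x \<ge> 0 \<Longrightarrow> \<bar>g x\<bar> \<le> C * x ^ n" "Re p > 0"
  shows "set_integrable lborel {0..} (\<lambda>x. of_real (g x) * exp (- (p * of_real x)))"
proof (rule set_integrable_bound)
  show "set_integrable lborel {0..} (\<lambda>x. C * (x ^ n * exp (- (Re p * x))))"
    using set_integrable_power_times_exp[OF assms(3), of n] by simp
  have "(\<lambda>x. of_real (g x) * exp (- (p * of_real x))) \<in> borel_measurable borel"
    by (intro borel_measurable_continuous_onI continuous_intros assms)
  thus "set_borel_measurable lborel {0..} (\<lambda>x. of_real (g x) * exp (- (p * of_real x)))"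
    unfolding set_borel_measurable_def by measurable
  have "norm (of_real (g x) * exp (- (p * of_real x))) \<le> norm (C * (x ^ n * exp (- (Re p * x))))"
    if "x \<ge> 0" for x
  proof -
    have "\<bar>g x\<bar> * exp (- (Re p * x)) \<le> \<bar>C\<bar> * x ^ n * exp (- (Re p * x))"
      using assms(2)[OF that] that
      by (intro mult_right_mono) (auto intro: order_trans[OF _ mult_right_mono[of C "\<bar>C\<bar>"]])
    thus ?thesis using that by (simp add: norm_mult abs_mult)
  qed
  thus "AE x in lborel. x \<in> {0..} \<longrightarrow>
      norm (of_real (g x) * exp (- (p * of_real x))) \<le> norm (C * (x ^ n * exp (- (Re p * x))))"
    by simp
qed

lemma tendsto_laplace_bounded:
  fixes g :: "real \<Rightarrow> real" and p :: complex
  assumes "\<And>x. x \<ge> 0 \<Longrightarrow> \<bar>g x\<bar> \<le> C * x ^ n" "Re p > 0"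
  shows "((\<lambda>x. of_real (g x) * exp (- (p * of_real x))) \<longlongrightarrow> 0) at_top"
proof (rule Lim_null_comparison)
  define s where "s = Re p"
  have s: "s > 0" using assms by (simp add: s_def)
  have "filterlim (\<lambda>x. s * x) at_top at_top"
    by (rule filterlim_tendsto_pos_mult_at_top[OF tendsto_const s filterlim_ident])
  hence "((\<lambda>x. C / s ^ n * ((s * x) ^ n / exp (s * x))) \<longlongrightarrow> C / s ^ n * 0) at_top"
    by (intro tendsto_mult tendsto_const filterlim_compose[OF tendsto_power_div_exp_0])
  also have "(\<lambda>x. C / s ^ n * ((s * x) ^ n / exp (s * x))) = (\<lambda>x. C * x ^ n * exp (- (s * x)))"
    using s by (auto simp: fun_eq_iff power_mult_distrib exp_minus field_simps)
  finally show "((\<lambda>x. C * x ^ n * exp (- (s * x))) \<longlongrightarrow> 0) at_top" by simp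
  show "eventually (\<lambda>x. norm (of_real (g x) * exp (- (p * of_real x))) \<le> C * x ^ n * exp (- (s * x))) at_top"
    using eventually_ge_at_top[of 0]
    by eventually_elim (auto simp: norm_mult s_def intro!: mult_right_mono assms)
qed

text \<open>Integration by parts: \<open>g' E - p g E\<close>, with \<open>E\<close> the exponential, is the derivative of \<open>g E\<close>.\<close>

lemma laplace_transform_deriv:
  fixes g g' :: "real \<Rightarrow> real" and p :: complex
  assumes deriv: "\<And>x. (g has_real_derivative g' x) (at x)"
    and cont: "continuous_on UNIV g'"
    and int: "set_integrable lborel {0..} (\<lambda>x. of_real (g x) * exp (- (p * of_real x)))"
      "set_integrable lborel {0..} (\<lambda>x. of_real (g' x) * exp (- (p * of_real x)))"
    and lim: "((\<lambda>x. of_real (g x) * exp (- (p * of_real x))) \<longlongrightarrow> 0) at_top"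
  shows "(LBINT x:{0..}. of_real (g' x) * exp (- (p * of_real x)))
    = p * (LBINT x:{0..}. of_real (g x) * exp (- (p * of_real x))) - of_real (g 0)"
proof -
  define E where "E = (\<lambda>x. exp (- (p * complex_of_real x)))"
  let ?F = "\<lambda>x. of_real (g x) * E x"
  let ?f = "\<lambda>x. of_real (g' x) * E x - p * (of_real (g x) * E x)"
  have cg: "continuous_on UNIV g"
    using deriv by (meson DERIV_isCont continuous_at_imp_continuous_on)
  have E': "(E has_vector_derivative - p * E x) (at x within S)" for x S
  proof -
    have "((\<lambda>z. exp (- (p * z))) has_field_derivative - p * exp (- (p * of_real x))) (at (of_real x))"
      by (auto intro!: derivative_eq_intros)
    from has_vector_derivative_real_field[OF this] show ?thesis unfolding E_def .
  qed
  have g': "((\<lambda>x. complex_of_real (g x)) has_vector_derivative of_real (g' x)) (at x within S)" for x S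
    using deriv[of x]
    by (intro has_vector_derivative_of_real)
       (simp add: has_real_derivative_iff_has_vector_derivative has_vector_derivative_at_within)
  have F': "(?F has_vector_derivative ?f x) (at x within S)" for x S
    using has_vector_derivative_mult[OF g' E'] by (simp add: algebra_simps)
  have cE: "continuous_on S E" for S
    unfolding E_def by (intro continuous_intros)
  have cf: "continuous_on S ?f" for S
    by (intro continuous_intros cE continuous_on_subset[OF cont] continuous_on_subset[OF cg]) auto
  have i1: "set_integrable lborel {0..} (\<lambda>x. of_real (g' x) * E x)"
    using int by (simp add: E_def)
  have i2: "set_integrable lborel {0..} (\<lambda>x. p * (of_real (g x) * E x))"
    using int by (simp add: E_def)
  have "((\<lambda>b. LBINT x:{0..b}. ?f x) \<longlongrightarrow> (LBINT x:{0..}. ?f x)) at_top"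
    by (intro tendsto_set_lebesgue_integral_at_top set_integral_diff i1 i2) auto
  moreover have "((\<lambda>b. LBINT x:{0..b}. ?f x) \<longlongrightarrow> 0 - ?F 0) at_top"
  proof (rule Lim_transform_eventually)
    show "((\<lambda>b. ?F b - ?F 0) \<longlongrightarrow> 0 - ?F 0) at_top"
      using lim by (intro tendsto_diff tendsto_const) (simp add: E_def)
    show "eventually (\<lambda>b. ?F b - ?F 0 = (LBINT x:{0..b}. ?f x)) at_top"
      using eventually_ge_at_top[of 0]
    proof eventually_elim
      case (elim b)
      show ?case unfolding set_lebesgue_integral_def
        by (rule integral_FTC_atLeastAtMost[OF elim F' cf, symmetric])
    qed
  qed
  ultimately have "(LBINT x:{0..}. ?f x) = 0 - ?F 0"
    by (intro tendsto_unique[OF trivial_limit_at_top_linorder])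
  moreover have "(LBINT x:{0..}. ?f x) = (LBINT x:{0..}. of_real (g' x) * E x)
      - p * (LBINT x:{0..}. of_real (g x) * E x)"
    using set_integral_diff(2)[OF i1 i2] by simp
  ultimately show ?thesis by (simp add: E_def algebra_simps)
qed

section \<open>Moments of the Bessel function against an exponential\<close>

text \<open>The orders are \<open>m - 1 / 2\<close> with \<open>m\<close> natural, so that the ladder runs through \<open>m\<close> from \<open>0\<close>;
the Bessel function in the theorem has \<open>m = (\<mu> + 1) / 2\<close>.\<close>

definition bessel_laplace :: "nat \<Rightarrow> real \<Rightarrow> complex \<Rightarrow> nat \<Rightarrow> complex" where
  "bessel_laplace m a p n = (LBINT x:{0..}. 
     of_real (x ^ n * bessel_J_norm (real m - 1 / 2) (a * x)) * exp (- (p * of_real x)))"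

lemma bessel_power_growth:
  "\<exists>C. \<forall>x\<ge>0. \<bar>x ^ n * bessel_J_norm (real m - 1 / 2) (a * x)\<bar> \<le> C * x ^ n"
proof -
  obtain C where "\<And>x. \<bar>bessel_J_norm (real m - 1 / 2) x\<bar> \<le> C"
    using bounded_bessel_J_norm by blast
  hence "\<bar>x ^ n * bessel_J_norm (real m - 1 / 2) (a * x)\<bar> \<le> C * x ^ n" if "x \<ge> 0" for x
    using mult_left_mono[of _ C "x ^ n"] that by (simp add: abs_mult mult.commute[of C])
  thus ?thesis by blast
qed

lemma continuous_on_bessel_J_norm [continuous_intros]:
  fixes f :: "'a :: topological_space \<Rightarrow> real"
  assumes "continuous_on S f"
  shows "continuous_on S (\<lambda>x. bessel_J_norm (\<alpha> :: real) (f x))"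
proof -
  have "continuous_on UNIV (bessel_J_norm \<alpha>)"
    using has_real_derivative_bessel_J_norm by (meson DERIV_isCont continuous_at_imp_continuous_on)
  from continuous_on_compose2[OF this assms] show ?thesis by simp
qed

lemma set_integrable_bessel_laplace:
  assumes "Re p > 0"
  shows "set_integrable lborel {0..}
     (\<lambda>x. of_real (x ^ n * bessel_J_norm (real m - 1 / 2) (a * x)) * exp (- (p * of_real x)))"
proof -
  obtain C where "\<And>x. x \<ge> 0 \<Longrightarrow> \<bar>x ^ n * bessel_J_norm (real m - 1 / 2) (a * x)\<bar> \<le> C * x ^ n"
    using bessel_power_growth by blast
  thus ?thesis
    using assms by (intro set_integrable_laplace_bounded continuous_intros) auto
qed

lemma tendsto_bessel_laplace:
  assumes "Re p > 0"
  shows "((\<lambda>x. of_real (x ^ n * bessel_J_norm (real m - 1 / 2) (a * x)) * exp (- (p * of_real x)))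
     \<longlongrightarrow> 0) at_top"
proof -
  obtain C where "\<And>x. x \<ge> 0 \<Longrightarrow> \<bar>x ^ n * bessel_J_norm (real m - 1 / 2) (a * x)\<bar> \<le> C * x ^ n"
    using bessel_power_growth by blast
  thus ?thesis using assms by (intro tendsto_laplace_bounded) auto
qed

text \<open>The transform of the derivative of \<open>x ^ n J_(m - 1/2)(a x)\<close>. The boundary term survives only
for \<open>n = 0\<close>, where it supplies the normalization of the whole family of moments.\<close>

lemma bessel_laplace_lower:
  assumes p: "Re p > 0"
  shows "of_nat n * bessel_laplace m a p (n - 1) - of_real (a\<^sup>2 / 2) * bessel_laplace (Suc m) a p (Suc n)
    = p * bessel_laplace m a p n - of_real (0 ^ n * bessel_J_norm (real m - 1 / 2) 0)"
proof -
  define J where "J = (\<lambda>m x. bessel_J_norm (real m - 1 / 2) (a * x))"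
  define E where "E = (\<lambda>x. exp (- (p * complex_of_real x)))"
  let ?g' = "\<lambda>x. real n * (x ^ (n - 1) * J m x) - a\<^sup>2 / 2 * (x ^ Suc n * J (Suc m) x)"
  have J': "(J m has_real_derivative (- (a * x / 2) * J (Suc m) x) * a) (at x)" for x
  proof -
    have "(bessel_J_norm (real m - 1 / 2) has_real_derivative - (a * x / 2) * J (Suc m) x) (at (a * x))"
      using has_real_derivative_bessel_J_norm[of "real m - 1 / 2" "a * x"]
      by (simp add: J_def diff_add_eq add.commute)
    thus ?thesis unfolding J_def by (rule DERIV_chain2) (rule DERIV_cmult_Id)
  qed
  have g': "((\<lambda>x. x ^ n * J m x) has_real_derivative ?g' x) (at x)" for x
    using DERIV_mult[OF DERIV_pow[of n x] J'] by (simp add: mult_ac power2_eq_square)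
  have i: "set_integrable lborel {0..} (\<lambda>x. of_real (x ^ n * J m x) * E x)" for m n
    using set_integrable_bessel_laplace[OF p] by (simp add: J_def E_def)
  have K: "(LBINT x:{0..}. of_real (x ^ n * J m x) * E x) = bessel_laplace m a p n" for m n
    by (simp add: J_def E_def bessel_laplace_def)
  have split: "of_real (?g' x) * E x = of_nat n * (of_real (x ^ (n - 1) * J m x) * E x)
      - of_real (a\<^sup>2 / 2) * (of_real (x ^ Suc n * J (Suc m) x) * E x)" for x
    by (simp add: algebra_simps)
  have i1: "set_integrable lborel {0..} (\<lambda>x. of_nat n * (of_real (x ^ (n - 1) * J m x) * E x))"
    and i2: "set_integrable lborel {0..} (\<lambda>x. of_real (a\<^sup>2 / 2) * (of_real (x ^ Suc n * J (Suc m) x) * E x))"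
    by (intro set_integrable_mult_right i)+
  have "(LBINT x:{0..}. of_real (?g' x) * E x)
      = p * (LBINT x:{0..}. of_real (x ^ n * J m x) * E x) - of_real (0 ^ n * J m 0)"
    unfolding E_def
  proof (rule laplace_transform_deriv[where g = "\<lambda>x. x ^ n * J m x"])
    show "continuous_on UNIV ?g'" unfolding J_def by (intro continuous_intros)
    show "set_integrable lborel {0..} (\<lambda>x. of_real (?g' x) * exp (- (p * of_real x)))"
      using set_integral_diff(1)[OF i1 i2] split by (simp only: E_def)
  qed (use g' i tendsto_bessel_laplace[OF p] in \<open>simp_all add: E_def J_def\<close>)
  also have "(LBINT x:{0..}. of_real (?g' x) * E x) = of_nat n * bessel_laplace m a p (n - 1)
      - of_real (a\<^sup>2 / 2) * bessel_laplace (Suc m) a p (Suc n)"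
    unfolding split set_integral_diff(2)[OF i1 i2] set_integral_mult_right K ..
  finally show ?thesis by (simp only: K) (simp add: J_def)
qed

text \<open>The transform of the derivative of \<open>x ^ k\<close> times \<open>x ^ (2 m + 1) J_(m + 1/2)(a x)\<close>.\<close>

lemma bessel_laplace_raise:
  assumes p: "Re p > 0"
  shows "2 * bessel_laplace m a p (2 * m + k) + of_nat k * bessel_laplace (Suc m) a p (2 * m + k)
    = p * bessel_laplace (Suc m) a p (2 * m + 1 + k)"
proof -
  define J where "J = (\<lambda>m x. bessel_J_norm (real m - 1 / 2) (a * x))"
  define E where "E = (\<lambda>x. exp (- (p * complex_of_real x)))"
  let ?g' = "\<lambda>x. 2 * (x ^ (2 * m + k) * J m x) + real k * (x ^ (2 * m + k) * J (Suc m) x)"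
  have g': "((\<lambda>x. x ^ (2 * m + 1 + k) * J (Suc m) x) has_real_derivative ?g' x) (at x)" for x
  proof -
    have "((\<lambda>x. x ^ (2 * m + 1) * J (Suc m) x) has_real_derivative 2 * x ^ (2 * m) * J m x) (at x)"
      using has_real_derivative_power_times_bessel_J_norm[of m a x] by (simp add: J_def add_ac)
    from DERIV_mult[OF DERIV_pow[of k x] this] show ?thesis
      by (cases k) (simp_all add: power_add mult_ac add_ac)
  qed
  have i: "set_integrable lborel {0..} (\<lambda>x. of_real (x ^ n * J m x) * E x)" for m n
    using set_integrable_bessel_laplace[OF p] by (simp add: J_def E_def)
  have K: "(LBINT x:{0..}. of_real (x ^ n * J m x) * E x) = bessel_laplace m a p n" for m n
    by (simp add: J_def E_def bessel_laplace_def)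
  have split: "of_real (?g' x) * E x = 2 * (of_real (x ^ (2 * m + k) * J m x) * E x)
      + of_nat k * (of_real (x ^ (2 * m + k) * J (Suc m) x) * E x)" for x
    by (simp add: algebra_simps)
  have i1: "set_integrable lborel {0..} (\<lambda>x. 2 * (of_real (x ^ (2 * m + k) * J m x) * E x))"
    and i2: "set_integrable lborel {0..} (\<lambda>x. of_nat k * (of_real (x ^ (2 * m + k) * J (Suc m) x) * E x))"
    by (intro set_integrable_mult_right i)+
  have "(LBINT x:{0..}. of_real (?g' x) * E x)
      = p * (LBINT x:{0..}. of_real (x ^ (2 * m + 1 + k) * J (Suc m) x) * E x)
        - of_real (0 ^ (2 * m + 1 + k) * J (Suc m) 0)"
    unfolding E_def
  proof (rule laplace_transform_deriv[where g = "\<lambda>x. x ^ (2 * m + 1 + k) * J (Suc m) x"])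
    show "continuous_on UNIV ?g'" unfolding J_def by (intro continuous_intros)
    show "set_integrable lborel {0..} (\<lambda>x. of_real (?g' x) * exp (- (p * of_real x)))"
      using set_integral_add(1)[OF i1 i2] split by (simp only: E_def)
    show "((\<lambda>x. of_real (x ^ (2 * m + 1 + k) * J (Suc m) x) * exp (- (p * of_real x))) \<longlongrightarrow> 0) at_top"
      using tendsto_bessel_laplace[OF p] by (simp only: J_def)
    show "set_integrable lborel {0..} (\<lambda>x. of_real (x ^ (2 * m + 1 + k) * J (Suc m) x) * exp (- (p * of_real x)))"
      using i by (simp only: E_def)
  qed (rule g')
  also have "(LBINT x:{0..}. of_real (?g' x) * E x) = 2 * bessel_laplace m a p (2 * m + k)
      + of_nat k * bessel_laplace (Suc m) a p (2 * m + k)"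
    unfolding split set_integral_add(2)[OF i1 i2] set_integral_mult_right K ..
  finally show ?thesis by (simp only: K) simp
qed

text \<open>Two instances of \<open>bessel_laplace_lower\<close> express the moments of the next order through those of
order \<open>m + 1 / 2\<close>, up to a factor \<open>a\<^sup>2 / 2\<close>. Multiplying \<open>bessel_laplace_raise\<close> by that factor
eliminates the next order without a division by \<open>a\<close>, which may vanish.\<close>

lemma bessel_laplace_recurrence:
  assumes p: "Re p > 0"
  shows "(p\<^sup>2 + (of_real a)\<^sup>2) * bessel_laplace (Suc m) a p (2 * m + 2 + k)
    = 2 * p * of_nat (m + 1 + k) * bessel_laplace (Suc m) a p (2 * m + 1 + k)
      - of_nat k * of_nat (2 * m + 1 + k) * bessel_laplace (Suc m) a p (2 * m + k)"
proof -
  define M where "M = bessel_laplace (Suc m) a p"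
  define V where "V = bessel_laplace (Suc (Suc m)) a p"
  define h where "h = (of_real a)\<^sup>2 / (2 :: complex)"
  have 1: "of_nat (2 * m + 1 + k) * M (2 * m + k) - h * V (2 * m + 2 + k) = p * M (2 * m + 1 + k)"
    using bessel_laplace_lower[OF p, of "2 * m + 1 + k" "Suc m" a] by (simp add: M_def V_def h_def)
  have 2: "of_nat (2 * m + 2 + k) * M (2 * m + 1 + k) - h * V (2 * m + 3 + k) = p * M (2 * m + 2 + k)"
    using bessel_laplace_lower[OF p, of "2 * m + 2 + k" "Suc m" a] 
    by (simp add: M_def V_def h_def eval_nat_numeral)
  have 3: "2 * M (2 * m + 2 + k) + of_nat k * V (2 * m + 2 + k) = p * V (2 * m + 3 + k)"
    using bessel_laplace_raise[OF p, of "Suc m" a k] by (simp add: M_def V_def eval_nat_numeral)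
  have "2 * h * M (2 * m + 2 + k) 
      = p * (h * V (2 * m + 3 + k)) - of_nat k * (h * V (2 * m + 2 + k))"
    using arg_cong[OF 3, of "\<lambda>z. h * z"] by (simp add: algebra_simps)
  also have "h * V (2 * m + 3 + k) = of_nat (2 * m + 2 + k) * M (2 * m + 1 + k) - p * M (2 * m + 2 + k)"
    using 2 by (simp add: algebra_simps)
  also have "h * V (2 * m + 2 + k) = of_nat (2 * m + 1 + k) * M (2 * m + k) - p * M (2 * m + 1 + k)"
    using 1 by (simp add: algebra_simps)
  finally show ?thesis
    unfolding M_def[symmetric] by (simp add: h_def power2_eq_square algebra_simps)
qed

text \<open>For order \<open>1 / 2\<close> the two ladder relations and the boundary value at \<open>0\<close> form a linear system
for two unknown moments. From one order to the next, \<open>bessel_laplace_raise\<close> leads back to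
the second moment of the lower order, which \<open>bessel_laplace_recurrence\<close> reduces to the first.\<close>

lemma bessel_laplace_closed_form:
  assumes p: "Re p > 0"
  shows "bessel_laplace (Suc m) a p (2 * m + 1) * (p\<^sup>2 + (of_real a)\<^sup>2) ^ Suc m
    = of_real (2 ^ (2 * m + 1) * fact m / sqrt pi)"
proof (induction m)
  case 0
  have r: "rGamma (1 / 2 :: real) = 1 / sqrt pi"
    by (simp add: rGamma_inverse_Gamma Gamma_one_half_real inverse_eq_divide)
  have "(\<Sum>k. (-1) ^ k * rGamma (- (1 / 2) + real k + 1) / fact k * (0 / 2) ^ (2 * k))
      = (\<Sum>k\<in>{0}. (-1) ^ k * rGamma (- (1 / 2) + real k + 1) / fact k * (0 / 2) ^ (2 * k))"
    by (rule suminf_finite) auto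
  hence J0: "bessel_J_norm (- 1 / 2 :: real) 0 = 1 / sqrt pi"
    by (simp add: bessel_J_norm_def r)
  define K where "K = bessel_laplace (Suc 0) a p 1"
  have 1: "p * bessel_laplace 0 a p 0 + of_real (a\<^sup>2 / 2) * K = of_real (1 / sqrt pi)"
    using bessel_laplace_lower[OF p, of 0 0 a] J0 by (simp add: K_def algebra_simps)
  have 2: "2 * bessel_laplace 0 a p 0 = p * K"
    using bessel_laplace_raise[OF p, of 0 a 0] by (simp add: K_def)
  have "K * (p\<^sup>2 + (of_real a)\<^sup>2) = p * (p * K) + 2 * (of_real (a\<^sup>2 / 2) * K)"
    by (simp add: power2_eq_square algebra_simps)
  also have "\<dots> = 2 * of_real (1 / sqrt pi)"
    unfolding 2[symmetric] 1[symmetric] by (simp add: algebra_simps)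
  finally show ?case by (simp add: K_def)
next
  case (Suc m)
  have "p \<noteq> 0" using p by auto
  let ?r = "p\<^sup>2 + (of_real a)\<^sup>2"
  have "p * (bessel_laplace (Suc (Suc m)) a p (2 * m + 3) * ?r)
      = 2 * (?r * bessel_laplace (Suc m) a p (2 * m + 2))"
    using bessel_laplace_raise[OF p, of "Suc m" a 0] by (simp add: eval_nat_numeral mult_ac)
  also have "\<dots> = p * (4 * of_nat (Suc m) * bessel_laplace (Suc m) a p (2 * m + 1))"
    using bessel_laplace_recurrence[OF p, of a m 0] by simp
  finally have "bessel_laplace (Suc (Suc m)) a p (2 * m + 3) * ?r
      = 4 * of_nat (Suc m) * bessel_laplace (Suc m) a p (2 * m + 1)"
    using \<open>p \<noteq> 0\<close> by simp
  hence "bessel_laplace (Suc (Suc m)) a p (2 * m + 3) * ?r ^ Suc (Suc m)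
      = 4 * of_nat (Suc m) * (bessel_laplace (Suc m) a p (2 * m + 1) * ?r ^ Suc m)"
    by (simp add: mult_ac)
  also have "\<dots> = of_real (2 ^ (2 * Suc m + 1) * fact (Suc m) / sqrt pi)"
    unfolding Suc.IH by (simp add: field_simps)
  finally show ?case by (simp add: eval_nat_numeral)
qed

section \<open>Generating functions of Laguerre and Gegenbauer polynomials\<close>

(* The dollar sign is also the component operator of vectors; it denotes coefficients below. *)
unbundle no vec_syntax

lemma fps_mult_compose_nth:
  fixes G A B :: "'a :: comm_ring_1 fps"
  assumes "B $ 0 = 0"
  shows "(G * (A oo B)) $ n = (\<Sum>i\<le>n. A $ i * (G * B ^ i) $ n)"
proof -
  have "(A oo B) $ k = (\<Sum>i\<le>n. A $ i * (B ^ i) $ k)" if "k \<le> n" for k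
  proof -
    have "(\<Sum>i\<le>n. A $ i * (B ^ i) $ k) = (\<Sum>i\<in>{0..k}. A $ i * (B ^ i) $ k)"
      using that by (intro sum.mono_neutral_right) (auto simp: startsby_zero_power_prefix[OF assms])
    thus ?thesis by (simp add: fps_compose_nth)
  qed
  hence "((A oo B) * G) $ n = (\<Sum>k=0..n. (\<Sum>i\<le>n. A $ i * (B ^ i) $ k) * G $ (n - k))"
    by (simp add: fps_mult_nth)
  also have "\<dots> = (\<Sum>i\<le>n. A $ i * (B ^ i * G) $ n)"
    unfolding sum_distrib_right by (subst sum.swap) (simp add: fps_mult_nth sum_distrib_left mult.assoc)
  finally show ?thesis by (simp only: mult.commute[of G])
qed

text \<open>The Laguerre generating function \<open>(1 - t) ^ (- \<mu> - 1) exp (- y t / (1 - t))\<close> with the powers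
of \<open>y\<close> replaced by moments: \<open>N k\<close> plays the role of the moment of order \<open>k\<close> over \<open>k!\<close>, and
\<open>c\<close> that of the factor \<open>- 2\<close> in \<open>- y = - 2 x\<close>.\<close>

lemma laguerre_generating_function:
  fixes N :: "nat \<Rightarrow> complex"
  shows "inverse ((1 - fps_X) ^ Suc \<mu>) * (Abs_fps N oo (fps_const c * fps_X * inverse (1 - fps_X)))
    = Abs_fps (\<lambda>n. \<Sum>k\<le>n. of_nat ((n + \<mu>) choose (n - k)) * c ^ k * N k)"
proof (rule fps_ext)
  fix n
  define B where "B = fps_const c * fps_X * inverse (1 - fps_X :: complex fps)"
  have 1: "(inverse ((1 - fps_X) ^ Suc \<mu>) * B ^ k) $ n = of_nat ((n + \<mu>) choose (n - k)) * c ^ k" 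
    if "k \<le> n" for k
  proof -
    have "inverse ((1 - fps_X) ^ Suc \<mu>) * B ^ k
        = fps_const (c ^ k) * (fps_X ^ k * inverse ((1 - fps_X) ^ (Suc \<mu> + k)))"
      by (simp only: B_def power_mult_distrib power_add fps_inverse_power fps_inverse_mult
          fps_const_power mult_ac)
    also have "inverse ((1 - fps_X) ^ (Suc \<mu> + k))
        = Abs_fps (\<lambda>i. of_nat ((Suc \<mu> + k + i - 1) choose i) * 1 ^ i :: complex)"
      using one_minus_const_fps_X_neg_power'[of "Suc \<mu> + k" "1 :: complex"] by simp
    finally show ?thesis
      using that by (simp add: fps_X_power_mult_nth add_ac)
  qed
  have "B $ 0 = 0" by (simp add: B_def)
  from fps_mult_compose_nth[OF this, of "inverse ((1 - fps_X) ^ Suc \<mu>)" "Abs_fps N" n]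
  have "(inverse ((1 - fps_X) ^ Suc \<mu>) * (Abs_fps N oo B)) $ n
      = (\<Sum>k\<le>n. N k * (inverse ((1 - fps_X) ^ Suc \<mu>) * B ^ k) $ n)"
    by simp
  also have "\<dots> = (\<Sum>k\<le>n. of_nat ((n + \<mu>) choose (n - k)) * c ^ k * N k)"
    by (intro sum.cong refl, subst 1) (simp_all add: mult_ac)
  finally show "(inverse ((1 - fps_X) ^ Suc \<mu>) * (Abs_fps N oo (fps_const c * fps_X * inverse (1 - fps_X)))) $ n
    = Abs_fps (\<lambda>n. \<Sum>k\<le>n. of_nat ((n + \<mu>) choose (n - k)) * c ^ k * N k) $ n"
    by (simp add: B_def)
qed

lemma fps_X_times_linear_power_nth:
  fixes b :: "'a :: comm_ring_1"
  assumes "k \<le> n"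
  shows "((fps_X * (fps_const b - fps_X)) ^ k) $ n
    = (if n - k \<le> k then (-1) ^ (n - k) * of_nat (k choose (n - k)) * b ^ (2 * k - n) else 0)"
proof -
  have "(fps_const b - fps_X) ^ k = (\<Sum>i\<le>k. of_nat (k choose i) * (- fps_X) ^ i * fps_const b ^ (k - i))"
    by (subst binomial_ring [symmetric]) (simp add: add.commute)
  also have "\<dots> = (\<Sum>i\<le>k. fps_const (of_nat (k choose i) * (-1) ^ i * b ^ (k - i)) * fps_X ^ i)"
  proof (intro sum.cong refl)
    fix i
    have "(- fps_X) ^ i = fps_const ((-1) ^ i :: 'a) * fps_X ^ i"
      by (simp only: power_minus[of "fps_X :: 'a fps"] fps_const_power[symmetric]
            fps_const_neg[symmetric] fps_const_1_eq_1)
    moreover have "of_nat (k choose i) = fps_const (of_nat (k choose i) :: 'a)"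
      by (simp only: fps_of_nat)
    ultimately show "of_nat (k choose i) * (- fps_X) ^ i * fps_const b ^ (k - i)
        = fps_const (of_nat (k choose i) * (-1) ^ i * b ^ (k - i)) * fps_X ^ i"
      by (simp only: fps_const_power fps_const_mult[symmetric] mult_ac)
  qed
  finally have "((fps_const b - fps_X) ^ k) $ j
      = (if j \<le> k then of_nat (k choose j) * (-1) ^ j * b ^ (k - j) else 0)" for j
    by (simp add: fps_sum_nth fps_X_power_nth if_distrib cong: if_cong)
  moreover have "((fps_X * (fps_const b - fps_X)) ^ k) $ n = ((fps_const b - fps_X) ^ k) $ (n - k)"
    using assms by (simp add: power_mult_distrib fps_X_power_mult_nth)
  moreover have "k - (n - k) = 2 * k - n" using assms by simp
  ultimately show ?thesis by simp
qed

text \<open>Substitute \<open>B = 2 x X - X\<^sup>2\<close> into the binomial series of \<open>(1 - X) ^ (- \<nu>)\<close>. As \<open>B\<close> is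
\<open>X (2 x - X)\<close>, its \<open>i\<close>-th power contributes to degree \<open>n\<close> a single monomial in \<open>x\<close>, and \<open>i = n - k\<close>
gives the \<open>k\<close>-th term of the explicit formula.\<close>

lemma gegenbauer_generating_function:
  fixes x :: real
  shows "Abs_fps (\<lambda>n. complex_of_real (gegenbauer n (real (Suc m)) x))
    * (1 - fps_const (2 * of_real x) * fps_X + fps_X\<^sup>2) ^ Suc m = 1"
proof -
  define \<nu> where "\<nu> = complex_of_nat (Suc m)"
  define A where "A = Abs_fps (\<lambda>k. pochhammer \<nu> k / fact k)"
  define B :: "complex fps" where "B = fps_X * (fps_const (2 * of_real x) - fps_X)"
  have "A = inverse ((1 - fps_X) ^ Suc m)"
  proof -
    have "pochhammer \<nu> k / fact k = of_nat ((Suc m + k - 1) choose k)" for k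
      by (simp add: \<nu>_def binomial_gbinomial gbinomial_pochhammer' add_ac)
    thus ?thesis
      using one_minus_const_fps_X_neg_power'[of "Suc m" "1 :: complex"] by (simp add: A_def)
  qed
  hence "A * (1 - fps_X) ^ Suc m = 1"
    by (simp only: inverse_mult_eq_1 fps_power_zeroth_eq_one fps_sub_nth fps_one_nth fps_X_nth)
       (simp add: inverse_mult_eq_1)
  hence "(A * (1 - fps_X) ^ Suc m) oo B = 1 oo B" by simp
  hence "(A oo B) * (1 - B) ^ Suc m = 1"
    by (subst (asm) fps_compose_mult_distrib)
       (simp_all add: B_def fps_compose_power[symmetric] fps_compose_sub_distrib del: power_Suc)
  moreover have "1 - B = 1 - fps_const (2 * of_real x) * fps_X + fps_X\<^sup>2"
    by (simp add: B_def algebra_simps power2_eq_square)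
  moreover have "A oo B = Abs_fps (\<lambda>n. of_real (gegenbauer n (real (Suc m)) x))"
  proof (rule fps_ext)
    fix n
    have "(A oo B) $ n = (\<Sum>k=0..n. pochhammer \<nu> k / fact k * (B ^ k) $ n)"
      by (simp add: fps_compose_nth A_def)
    also have "\<dots> = (\<Sum>k=0..n. pochhammer \<nu> (n - k) / fact (n - k) * (B ^ (n - k)) $ n)"
      by (rule sum.reindex_bij_witness[of _ "\<lambda>k. n - k" "\<lambda>k. n - k"]) auto
    \<comment> \<open>For k > n div 2 the monomial would have a negative exponent; its coefficient is 0.\<close>
    also have "\<dots> = (\<Sum>k\<le>n div 2. pochhammer \<nu> (n - k) / fact (n - k) * (B ^ (n - k)) $ n)"
      unfolding B_def
      by (intro sum.mono_neutral_right) (auto simp: fps_X_times_linear_power_nth)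
    also have "\<dots> = of_real (gegenbauer n (real (Suc m)) x)"
      unfolding gegenbauer_def of_real_sum
    proof (rule sum.cong)
      fix k assume "k \<in> {..n div 2}"
      hence k: "2 * k \<le> n" by auto
      hence "(B ^ (n - k)) $ n = (-1) ^ k * of_nat ((n - k) choose k) * (2 * of_real x) ^ (n - 2 * k)"
        unfolding B_def by (subst fps_X_times_linear_power_nth) (auto simp: diff_mult_distrib2)
      also have "complex_of_nat ((n - k) choose k) = fact (n - k) / (fact k * fact (n - 2 * k))"
        using k by (subst binomial_fact) (auto simp: mult_2)
      finally show "pochhammer \<nu> (n - k) / fact (n - k) * (B ^ (n - k)) $ n
          = of_real ((-1) ^ k * pochhammer (real (Suc m)) (n - k) / (fact k * fact (n - 2 * k))
              * (2 * x) ^ (n - 2 * k))"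
        by (simp add: \<nu>_def pochhammer_of_real[symmetric])
    qed simp
    finally show "(A oo B) $ n = Abs_fps (\<lambda>n. of_real (gegenbauer n (real (Suc m)) x)) $ n" by simp
  qed
  ultimately show ?thesis by (simp only:)
qed

section \<open>The Laguerre transform of the moments\<close>

text \<open>With \<open>q = (p - X)\<^sup>2 + a\<^sup>2\<close> and \<open>l = 2 (m + 1)\<close>, the recurrence of the moments reads
\<open>P' q = l (p - X) P\<close>, while \<open>q' = - 2 (p - X)\<close>. Hence \<open>P q ^ (m + 1)\<close> has derivative \<open>0\<close> and equals
its constant term, which is known.\<close>

lemma bessel_laplace_generating_function:
  fixes p :: complex and a :: real and m :: nat
  assumes p: "Re p > 0"
  defines "P \<equiv> Abs_fps (\<lambda>k. bessel_laplace (Suc m) a p (2 * m + 1 + k) / fact k)"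
  shows "P * ((fps_const p - fps_X)\<^sup>2 + fps_const (of_real a ^ 2)) ^ Suc m
    = fps_const (of_real (2 ^ (2 * m + 1) * fact m / sqrt pi))"
proof -
  define M where "M = bessel_laplace (Suc m) a p"
  define N where "N = (\<lambda>k. M (2 * m + 1 + k) / fact k)"
  have P: "P = Abs_fps N" by (simp add: P_def N_def M_def)
  define r where "r = p\<^sup>2 + (of_real a)\<^sup>2"
  define q where "q = (fps_const p - fps_X)\<^sup>2 + fps_const (of_real a ^ 2)"
  define l where "l = of_nat (Suc m) * (2 :: complex)"
  have rec: "r * (of_nat (Suc k) * N (Suc k)) = p * (l + 2 * of_nat k) * N k
      - (if k = 0 then 0 else (l + of_nat k - 1) * N (k - 1))" for k
  proof -
    have "r * (of_nat (Suc k) * N (Suc k)) = r * M (2 * m + 2 + k) / fact k"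
      using of_nat_neq_0[of k, where ?'a = complex] by (simp add: N_def field_simps del: of_nat_Suc)
    also have "r * M (2 * m + 2 + k) = p * (l + 2 * of_nat k) * M (2 * m + 1 + k)
        - of_nat k * (l + of_nat k - 1) * M (2 * m + k)"
      using bessel_laplace_recurrence[OF p, of a m k] by (simp add: M_def r_def l_def algebra_simps)
    also have "\<dots> / fact k = p * (l + 2 * of_nat k) * N k
        - of_nat k * (l + of_nat k - 1) * M (2 * m + k) / fact k"
      by (simp add: N_def diff_divide_distrib)
    also have "of_nat k * (l + of_nat k - 1) * M (2 * m + k) / fact k
        = (if k = 0 then 0 else (l + of_nat k - 1) * N (k - 1))"
    proof (cases k)
      case (Suc i)
      have "fact k = of_nat k * (fact i :: complex)" "of_nat k \<noteq> (0 :: complex)"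
        by (simp_all add: Suc del: of_nat_Suc)
      thus ?thesis by (simp add: Suc N_def del: of_nat_Suc fact_Suc)
    qed simp
    finally show ?thesis .
  qed
  have q: "q = fps_const r - fps_const (2 * p) * fps_X + fps_X * fps_X"
    by (simp add: q_def r_def power2_eq_square algebra_simps flip: fps_const_mult fps_const_add)
  have "fps_deriv P * q = fps_const l * (fps_const p - fps_X) * P"
  proof (rule fps_ext)
    fix k
    show "(fps_deriv P * q) $ k = (fps_const l * (fps_const p - fps_X) * P) $ k"
    proof (cases k)
      case 0
      thus ?thesis using rec[of 0] by (simp add: P q algebra_simps)
    next
      case (Suc i)
      have "(fps_deriv P * q) $ k = r * (of_nat (Suc k) * N (Suc k)) - 2 * p * (of_nat k * N k)
          + of_nat i * N i"
        unfolding q Suc by (cases i) (simp_all add: P algebra_simps)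
      also have "\<dots> = l * (p * N k - N i)"
        unfolding rec using Suc by (simp add: algebra_simps)
      also have "\<dots> = (fps_const l * (fps_const p - fps_X) * P) $ k"
        unfolding Suc by (simp add: P algebra_simps)
      finally show ?thesis .
    qed
  qed
  moreover have "fps_deriv q = - 2 * (fps_const p - fps_X)"
    by (simp add: q_def power2_eq_square algebra_simps)
  moreover have "fps_const l = of_nat (Suc m) * 2"
    by (simp add: l_def fps_of_nat[symmetric] fps_numeral_fps_const)
  ultimately have "fps_deriv P * q + of_nat (Suc m) * fps_deriv q * P = 0"
    by algebra
  moreover have "fps_deriv (P * q ^ Suc m) = q ^ m * (fps_deriv P * q + of_nat (Suc m) * fps_deriv q * P)"
    unfolding fps_deriv_mult fps_deriv_power' diff_Suc_1 by (simp add: algebra_simps del: of_nat_Suc)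
  ultimately have "fps_deriv (P * q ^ Suc m) = 0" by simp
  hence "P * q ^ Suc m = fps_const ((P * q ^ Suc m) $ 0)"
    by (simp only: fps_deriv_eq_0_iff)
  also have "(P * q ^ Suc m) $ 0 = N 0 * r ^ Suc m"
    by (simp add: P q fps_power_zeroth del: power_Suc)
  also have "\<dots> = of_real (2 ^ (2 * m + 1) * fact m / sqrt pi)"
    using bessel_laplace_closed_form[OF p, of m a] by (simp add: N_def M_def r_def)
  finally show ?thesis unfolding q_def .
qed

lemma laguerre_bessel_laplace_expand:
  fixes p :: complex and a :: real and m j :: nat
  assumes p: "Re p > 0"
  defines "f \<equiv> \<lambda>x. of_real (laguerre j (real (2 * m + 1)) (2 * x)
      * bessel_J_norm (real (2 * m + 1) / 2) (a * x) * x ^ (2 * m + 1)) * exp (- (p * of_real x))"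
  shows "set_integrable lborel {0..} f"
    and "(LBINT x:{0..}. f x) = (\<Sum>k\<le>j. of_nat ((j + (2 * m + 1)) choose (j - k)) * (- 2) ^ k
           * (bessel_laplace (Suc m) a p (2 * m + 1 + k) / fact k))"
proof -
  define c where "c = (\<lambda>k. of_nat ((j + (2 * m + 1)) choose (j - k)) * (- 2) ^ k / fact k :: complex)"
  define h where "h = (\<lambda>k x. of_real (x ^ (2 * m + 1 + k) * bessel_J_norm (real (Suc m) - 1 / 2) (a * x))
      * exp (- (p * of_real x)))"
  have i: "set_integrable lborel {0..} (h k)" for k
    unfolding h_def by (rule set_integrable_bessel_laplace[OF p])
  have L: "laguerre j (real (2 * m + 1)) (2 * x)
      = (\<Sum>k\<le>j. of_nat ((j + (2 * m + 1)) choose (j - k)) * (- 2) ^ k * x ^ k / fact k)" for x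
    unfolding laguerre_def
  proof (intro sum.cong refl)
    fix k
    have "(-2 :: real) ^ k = (-1) ^ k * 2 ^ k"
      by (simp flip: power_mult_distrib)
    moreover have "(real j + real (2 * m + 1)) gchoose (j - k) = of_nat ((j + (2 * m + 1)) choose (j - k))"
      by (simp only: binomial_gbinomial of_nat_add)
    ultimately show "(- 1) ^ k * ((real j + real (2 * m + 1)) gchoose (j - k)) * (2 * x) ^ k / fact k
        = real ((j + (2 * m + 1)) choose (j - k)) * (- 2) ^ k * x ^ k / fact k"
      by (simp only: power_mult_distrib mult_ac)
  qed
  have a1: "real (2 * m + 1) / 2 = real (Suc m) - 1 / 2" by (simp add: field_simps)
  have f: "f = (\<lambda>x. \<Sum>k\<le>j. c k * h k x)"
    unfolding f_def L h_def c_def a1 fun_eq_iff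
    by (simp add: sum_distrib_left sum_distrib_right power_add mult_ac)
  show "set_integrable lborel {0..} f"
    unfolding f set_integrable_def scaleR_sum_right
    by (intro Bochner_Integration.integrable_sum)
       (use i in \<open>simp add: set_integrable_def flip: mult_scaleR_right\<close>)
  have "(LBINT x:{0..}. f x) = (\<Sum>k\<le>j. LBINT x:{0..}. c k * h k x)"
    unfolding f set_lebesgue_integral_def scaleR_sum_right
    by (intro Bochner_Integration.integral_sum)
       (use i in \<open>simp add: set_integrable_def flip: mult_scaleR_right\<close>)
  also have "\<dots> = (\<Sum>k\<le>j. of_nat ((j + (2 * m + 1)) choose (j - k)) * (- 2) ^ k
           * (bessel_laplace (Suc m) a p (2 * m + 1 + k) / fact k))"
    unfolding set_integral_mult_right c_def h_def bessel_laplace_def[symmetric] by simp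
  finally show "(LBINT x:{0..}. f x) = \<dots>" .
qed

text \<open>The three hypotheses on \<open>p\<close>, \<open>a\<close> say that the quadratic
\<open>(p (1 - X) + 2 X)\<^sup>2 + a\<^sup>2 (1 - X)\<^sup>2\<close>, which the substitution \<open>X := - 2 X / (1 - X)\<close> produces from
\<open>(p - X)\<^sup>2 + a\<^sup>2\<close> after multiplication by \<open>(1 - X)\<^sup>2\<close>, is \<open>\<epsilon> (1 - 2 t r X + (r X)\<^sup>2)\<close>. The
Laguerre factor \<open>(1 - X) ^ (- 2 m - 2)\<close> has exactly the exponent needed for that multiplication.\<close>

lemma laguerre_bessel_laplace:
  fixes p \<epsilon> r :: complex and a t :: real and m j :: nat
  assumes p: "Re p > 0" and \<epsilon>: "\<epsilon> \<noteq> 0"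
    and 0: "p\<^sup>2 + (of_real a)\<^sup>2 = \<epsilon>"
    and 1: "p * (2 - p) - (of_real a)\<^sup>2 = - (\<epsilon> * r * of_real t)"
    and 2: "(2 - p)\<^sup>2 + (of_real a)\<^sup>2 = \<epsilon> * r\<^sup>2"
  shows "(LBINT x:{0..}. of_real (laguerre j (real (2 * m + 1)) (2 * x)
      * bessel_J_norm (real (2 * m + 1) / 2) (a * x) * x ^ (2 * m + 1)) * exp (- (p * of_real x)))
    = of_real (2 ^ (2 * m + 1) * fact m / sqrt pi) / \<epsilon> ^ Suc m * r ^ j
      * of_real (gegenbauer j (real (Suc m)) t)"
proof -
  define N where "N = (\<lambda>k. bessel_laplace (Suc m) a p (2 * m + 1 + k) / fact k)"
  define c where "c = complex_of_real (2 ^ (2 * m + 1) * fact m / sqrt pi)"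
  define Q where "Q = Abs_fps (\<lambda>j. \<Sum>k\<le>j. of_nat ((j + (2 * m + 1)) choose (j - k)) * (- 2) ^ k * N k)"
  define Y where "Y = (1 - fps_X :: complex fps)"
  define B where "B = fps_const (- 2) * fps_X * inverse Y"
  define G where "G = Abs_fps (\<lambda>n. complex_of_real (gegenbauer n (real (Suc m)) t))"
  define R where "R = fps_const r * fps_X"
  define S where "S = 1 - fps_const (2 * of_real t) * R + R\<^sup>2"
  define q where "q = (fps_const p - B)\<^sup>2 + fps_const (of_real a ^ 2)"
  have Y: "Y $ 0 \<noteq> 0" by (simp add: Y_def)
  have B0: "B $ 0 = 0" by (simp add: B_def)
  have YB: "Y * B = fps_const (- 2) * fps_X"
    using inverse_mult_eq_1'[OF Y] by (simp only: B_def mult_ac) (simp add: mult_ac)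
  have Q: "Q = inverse (Y ^ Suc (2 * m + 1)) * (Abs_fps N oo B)"
    unfolding Q_def Y_def B_def by (rule laguerre_generating_function[symmetric])
  have "(Abs_fps N * ((fps_const p - fps_X)\<^sup>2 + fps_const (of_real a ^ 2)) ^ Suc m) oo B = fps_const c oo B"
    unfolding N_def bessel_laplace_generating_function[OF p] c_def ..
  hence PB: "(Abs_fps N oo B) * q ^ Suc m = fps_const c"
    using B0 by (simp add: fps_compose_mult_distrib fps_compose_power[symmetric] fps_compose_add_distrib
        fps_compose_sub_distrib q_def del: power_Suc)
  have "Y\<^sup>2 * q = (fps_const p * Y - Y * B)\<^sup>2 + fps_const (of_real a ^ 2) * Y\<^sup>2"
    by (simp add: q_def power2_eq_square algebra_simps flip: fps_const_add fps_const_mult)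
  also have "fps_const p * Y - Y * B = fps_const p * (1 - fps_X) + 2 * fps_X"
    unfolding YB by (simp add: Y_def fps_numeral_fps_const flip: fps_const_neg)
  also have "(fps_const p * (1 - fps_X) + 2 * fps_X)\<^sup>2 + fps_const (of_real a ^ 2) * Y\<^sup>2
      = (fps_const p ^ 2 + fps_const (of_real a ^ 2))
        + 2 * (fps_const p * (2 - fps_const p) - fps_const (of_real a ^ 2)) * fps_X
        + ((2 - fps_const p)\<^sup>2 + fps_const (of_real a ^ 2)) * fps_X\<^sup>2"
    unfolding Y_def by algebra
  also have "fps_const p ^ 2 + fps_const (of_real a ^ 2) = fps_const \<epsilon>"
    by (simp add: 0[symmetric])
  also have "fps_const p * (2 - fps_const p) - fps_const (of_real a ^ 2) = fps_const (- (\<epsilon> * r * of_real t))"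
    by (simp add: 1[symmetric] fps_numeral_fps_const)
  also have "(2 - fps_const p)\<^sup>2 + fps_const (of_real a ^ 2) = fps_const (\<epsilon> * r\<^sup>2)"
    by (simp add: 2[symmetric] fps_numeral_fps_const)
  also have "fps_const \<epsilon> + 2 * fps_const (- (\<epsilon> * r * of_real t)) * fps_X + fps_const (\<epsilon> * r\<^sup>2) * fps_X\<^sup>2
      = fps_const \<epsilon> * S"
  proof -
    have "fps_const (- (\<epsilon> * r * of_real t)) = - (fps_const \<epsilon> * fps_const r * fps_const (of_real t))"
      and "fps_const (\<epsilon> * r\<^sup>2) = fps_const \<epsilon> * fps_const r ^ 2"
      and "fps_const (2 * complex_of_real t) = 2 * fps_const (of_real t)"
      by (simp_all add: fps_numeral_fps_const)
    thus ?thesis unfolding S_def R_def by algebra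
  qed
  finally have Yq: "Y\<^sup>2 * q = fps_const \<epsilon> * S" .
  have "(G * (1 - fps_const (2 * of_real t) * fps_X + fps_X\<^sup>2) ^ Suc m) oo R = 1 oo R"
    unfolding G_def gegenbauer_generating_function ..
  hence GS: "(G oo R) * S ^ Suc m = 1"
    by (subst (asm) fps_compose_mult_distrib)
       (simp_all add: R_def S_def fps_compose_power[symmetric] fps_compose_add_distrib
          fps_compose_sub_distrib fps_compose_mult_distrib del: power_Suc)
  have "Q * (Y\<^sup>2 * q) ^ Suc m = inverse (Y ^ Suc (2 * m + 1)) * Y ^ Suc (2 * m + 1) 
      * ((Abs_fps N oo B) * q ^ Suc m)"
    by (simp add: Q power_mult_distrib power_mult[symmetric] mult_ac del: power_Suc)
  also have "inverse (Y ^ Suc (2 * m + 1)) * Y ^ Suc (2 * m + 1) = 1"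
    by (rule inverse_mult_eq_1) (simp add: Y_def fps_power_zeroth del: power_Suc)
  finally have "Q * (fps_const \<epsilon> * S) ^ Suc m = fps_const c"
    by (simp only: PB Yq mult_1_left)
  hence "fps_const (\<epsilon> ^ Suc m) * Q * ((G oo R) * S ^ Suc m) = fps_const c * (G oo R)"
    by (simp only: power_mult_distrib fps_const_power mult_ac)
  hence "fps_const (\<epsilon> ^ Suc m) * Q = fps_const c * Abs_fps (\<lambda>n. r ^ n * G $ n)"
    unfolding GS by (simp only: R_def fps_compose_linear mult_1_right)
  from arg_cong[OF this, of "\<lambda>F. F $ j"] have "Q $ j = c / \<epsilon> ^ Suc m * r ^ j * G $ j"
    using \<epsilon> by (simp add: field_simps)
  thus ?thesis
    unfolding laguerre_bessel_laplace_expand(2)[OF p] by (simp add: Q_def N_def c_def G_def)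
qed

section \<open>The integral formula\<close>

theorem corollaryC:
  fixes \<mu> j :: nat and \<theta> \<phi> a b :: real
  assumes "odd \<mu>"
    and "cos \<theta> + cos \<phi> > 0"
    and "a = sin \<theta> / (cos \<theta> + cos \<phi>)"
    and "b = sin \<phi> / (cos \<theta> + cos \<phi>)"
  shows "set_integrable lborel {0..}
           (\<lambda>x. laguerre j (real \<mu>) (2 * x) * bessel_J_norm (real \<mu> / 2) (a * x)
                * cos (b * x) * x ^ \<mu> * exp (- x))
    \<and> (LBINT x:{0..}. laguerre j (real \<mu>) (2 * x) * bessel_J_norm (real \<mu> / 2) (a * x)
                * cos (b * x) * x ^ \<mu> * exp (- x))
         = (-1) ^ j * (2 ^ \<mu> / sqrt pi) * ((cos \<theta> + cos \<phi>) / 2) powr ((real \<mu> + 1) / 2)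
           * cos ((real j + (real \<mu> + 1) / 2) * \<phi>) * gegenbauer_norm j ((real \<mu> + 1) / 2) (cos \<theta>)
    \<and> set_integrable lborel {0..}
           (\<lambda>x. laguerre j (real \<mu>) (2 * x) * bessel_J_norm (real \<mu> / 2) (a * x)
                * sin (b * x) * x ^ \<mu> * exp (- x))
    \<and> (LBINT x:{0..}. laguerre j (real \<mu>) (2 * x) * bessel_J_norm (real \<mu> / 2) (a * x)
                * sin (b * x) * x ^ \<mu> * exp (- x))
         = (-1) ^ j * (2 ^ \<mu> / sqrt pi) * ((cos \<theta> + cos \<phi>) / 2) powr ((real \<mu> + 1) / 2)
           * sin ((real j + (real \<mu> + 1) / 2) * \<phi>) * gegenbauer_norm j ((real \<mu> + 1) / 2) (cos \<theta>)"
proof -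
  obtain m where \<mu>: "\<mu> = 2 * m + 1" using assms(1) by (elim oddE)
  define d where "d = cos \<theta> + cos \<phi>"
  have d: "d > 0" using assms(2) by (simp add: d_def)
  define p where "p = Complex 1 (- b)"
  define \<epsilon> where "\<epsilon> = of_real (2 / d) * cis (- \<phi>)"
  define r where "r = - cis \<phi>"
  define c where "c = 2 ^ \<mu> * fact m / sqrt pi"
  define W where "W = (-1) ^ j * c * (d / 2) ^ Suc m * gegenbauer j (real (Suc m)) (cos \<theta>)"
  define L where "L = (\<lambda>x. laguerre j (real \<mu>) (2 * x) * bessel_J_norm (real \<mu> / 2) (a * x))"
  define f where "f = (\<lambda>x. complex_of_real (L x * x ^ \<mu>) * exp (- (p * of_real x)))"
  have ad: "a * d = sin \<theta>" and bd: "b * d = sin \<phi>"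
    using d by (simp_all add: assms(3,4) d_def)
  \<comment> \<open>Both identities below come from clearing d and replacing the squares of sines.\<close>
  have s\<theta>: "(sin \<theta>)\<^sup>2 = 1 - (cos \<theta>)\<^sup>2" and s\<phi>: "(sin \<phi>)\<^sup>2 = 1 - (cos \<phi>)\<^sup>2"
    by (simp_all add: sin_squared_eq)
  have cancel: "X = Y / d" if "X * d\<^sup>2 = Y * d" for X Y
  proof -
    have "(X * d) * d = Y * d" using that by (simp add: power2_eq_square mult.assoc)
    thus ?thesis using d by (simp add: eq_divide_eq)
  qed
  have "(1 - b\<^sup>2 + a\<^sup>2) * d\<^sup>2 = d\<^sup>2 - (sin \<phi>)\<^sup>2 + (sin \<theta>)\<^sup>2"
    by (simp add: ad[symmetric] bd[symmetric] power_mult_distrib algebra_simps)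
  also have "\<dots> = 2 * cos \<phi> * d"
    by (simp add: s\<theta> s\<phi>) (simp add: d_def power2_eq_square algebra_simps)
  finally have re: "1 - b\<^sup>2 + a\<^sup>2 = 2 * cos \<phi> / d"
    by (rule cancel)
  have "(1 + b\<^sup>2 - a\<^sup>2) * d\<^sup>2 = d\<^sup>2 + (sin \<phi>)\<^sup>2 - (sin \<theta>)\<^sup>2"
    by (simp add: ad[symmetric] bd[symmetric] power_mult_distrib algebra_simps)
  also have "\<dots> = 2 * cos \<theta> * d"
    by (simp add: s\<theta> s\<phi>) (simp add: d_def power2_eq_square algebra_simps)
  finally have mid: "1 + b\<^sup>2 - a\<^sup>2 = 2 * cos \<theta> / d"
    by (rule cancel)
  have b: "b = sin \<phi> / d" using d bd by (simp add: field_simps)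
  have 0: "p\<^sup>2 + (of_real a)\<^sup>2 = \<epsilon>"
    using re by (simp add: complex_eq_iff p_def \<epsilon>_def power2_eq_square b)
  have "\<epsilon> * r = - of_real (2 / d)"
    by (simp add: \<epsilon>_def r_def cis_mult)
  hence 1: "p * (2 - p) - (of_real a)\<^sup>2 = - (\<epsilon> * r * of_real (cos \<theta>))"
    using mid by (simp add: complex_eq_iff p_def power2_eq_square)
  have "\<epsilon> * r\<^sup>2 = of_real (2 / d) * cis \<phi>"
    by (simp add: \<epsilon>_def r_def power2_eq_square cis_mult)
  hence 2: "(2 - p)\<^sup>2 + (of_real a)\<^sup>2 = \<epsilon> * r\<^sup>2"
    using re by (simp add: complex_eq_iff p_def power2_eq_square b)
  have p: "Re p > 0" by (simp add: p_def)
  have \<epsilon>: "\<epsilon> \<noteq> 0" using d by (simp add: \<epsilon>_def)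
  have int: "set_integrable lborel {0..} f"
    unfolding f_def L_def \<mu> by (rule laguerre_bessel_laplace_expand(1)[OF p])
  have inv: "1 / \<epsilon> ^ Suc m = of_real ((d / 2) ^ Suc m) * cis (real (Suc m) * \<phi>)"
  proof -
    have "1 / \<epsilon> = of_real (d / 2) * cis \<phi>"
      using d by (simp add: \<epsilon>_def cis_inverse[symmetric] field_simps)
    hence "(1 / \<epsilon>) ^ Suc m = of_real ((d / 2) ^ Suc m) * cis (real (Suc m) * \<phi>)"
      by (simp only: power_mult_distrib Complex.DeMoivre of_real_power)
    thus ?thesis by (simp add: power_one_over)
  qed
  have "(LBINT x:{0..}. f x) = of_real c / \<epsilon> ^ Suc m * r ^ j * of_real (gegenbauer j (real (Suc m)) (cos \<theta>))"
    unfolding f_def L_def c_def \<mu> by (rule laguerre_bessel_laplace[OF p \<epsilon> 0 1 2])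
  also have "\<dots> = of_real c * (1 / \<epsilon> ^ Suc m) * ((-1) ^ j * cis (real j * \<phi>))
      * of_real (gegenbauer j (real (Suc m)) (cos \<theta>))"
    by (simp add: r_def power_minus[of "cis \<phi>"] Complex.DeMoivre)
  also have "\<dots> = of_real W * (cis (real (Suc m) * \<phi>) * cis (real j * \<phi>))"
    unfolding inv by (simp add: W_def)
  also have "cis (real (Suc m) * \<phi>) * cis (real j * \<phi>) = cis ((real j + real (Suc m)) * \<phi>)"
    by (simp add: cis_mult algebra_simps)
  finally have val: "(LBINT x:{0..}. f x) = of_real W * cis ((real j + real (Suc m)) * \<phi>)" .
  have h: "(real \<mu> + 1) / 2 = real (Suc m)" by (simp add: \<mu>)
  have W: "W = (-1) ^ j * (2 ^ \<mu> / sqrt pi) * ((cos \<theta> + cos \<phi>) / 2) powr ((real \<mu> + 1) / 2)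
      * gegenbauer_norm j ((real \<mu> + 1) / 2) (cos \<theta>)"
  proof -
    have "((cos \<theta> + cos \<phi>) / 2) powr real (Suc m) = (d / 2) ^ Suc m"
      unfolding d_def[symmetric] by (rule powr_realpow) (use d in simp)
    moreover have "Gamma (real (Suc m)) = fact m"
      using Gamma_fact[of m, where ?'a = real] by (simp add: add.commute)
    ultimately show ?thesis
      unfolding h gegenbauer_norm_def W_def c_def by (simp only:) simp
  qed
  have e: "exp (- (p * of_real x)) = of_real (exp (- x)) * cis (b * x)" for x
    by (simp add: complex_eq_iff p_def Re_exp Im_exp)
  have Re: "Re (f x) = L x * cos (b * x) * x ^ \<mu> * exp (- x)" for x
    by (simp add: f_def e)
  have Im: "Im (f x) = L x * sin (b * x) * x ^ \<mu> * exp (- x)" for x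
    by (simp add: f_def e)
  have fi: "integrable lborel (\<lambda>x. indicator {0..} x *\<^sub>R f x)"
    using int by (simp only: set_integrable_def)
  have "set_integrable lborel {0..} (\<lambda>x. Re (f x))" "set_integrable lborel {0..} (\<lambda>x. Im (f x))"
    using integrable_bounded_linear[OF bounded_linear_Re fi] integrable_bounded_linear[OF bounded_linear_Im fi]
    by (simp_all add: set_integrable_def)
  moreover have "(LBINT x:{0..}. Re (f x)) = W * cos ((real j + real (Suc m)) * \<phi>)"
    using integral_bounded_linear[OF bounded_linear_Re fi] arg_cong[OF val, of Re]
    by (simp add: set_lebesgue_integral_def)
  moreover have "(LBINT x:{0..}. Im (f x)) = W * sin ((real j + real (Suc m)) * \<phi>)"
    using integral_bounded_linear[OF bounded_linear_Im fi] arg_cong[OF val, of Im]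
    by (simp add: set_lebesgue_integral_def)
  ultimately show ?thesis
    unfolding Re Im W L_def h[symmetric] by (simp add: mult_ac)
qed

end
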